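(* Let $q$ be a prime power, $N\ge 3$, $1\le k\le N-1$, and let $2 \le \rho \le N$ and $\rho \le \ell \le (q^\rho-1)/(q-1)$ be integers. Then $$\hat{\delta}_q(N,k,\ell,\rho)= \frac{\lambda_q(N,k,\ell,\rho)}{\lambda_q(N,0,\ell,\rho)}.$$
   Context: Let $X$ be an $N$-dimensional $\mathbb{F}_q$-space, $\mathcal{G}_q(X,j)$ the set of its $j$-dimensional subspaces. A point set is a nonempty $P\subseteq\mathcal{G}_q(X,1)$, $\langle P\rangle=\sum_{L\in P}L$; $V\le X$ distinguishes $P$ if no element of $P$ lies in $V$. $\delta_q(X,k,P)$ is the number of $V\in\mathcal{G}_q(X,k)$ distinguishing $P$ divided by $|\mathcal{G}_q(X,k)|$. $\hat\delta_q(N,k,\ell,\rho)$ is the average of $\delta_q(X,k,P)$ over all point sets $P$ with $|P|=\ell$ and $\dim\langle P\rangle=\rho$. With $\begin{bmatrix} a\\ b\end{bmatrix}_q=\prod_{j=0}^{b-1}\frac{q^a-q^j}{q^b-q^j}$ (and $0$ if $b>a$ or $b<0$), for $0\le s\le N$ define $$\lambda_q(N,s,\ell,\rho)= \sum_{i=0}^\rho (-1)^{\rho-i} \, q^{\binom{\rho-i}{2}} \begin{bmatrix} N-i\\ \rho-i\end{bmatrix}_q \sum_{t=0}^s \binom{\frac{q^i-q^t}{q-1}}{\ell} \begin{bmatrix} s\\ t\end{bmatrix}_q \begin{bmatrix} N-s\\ i-t\end{bmatrix}_q q^{(s-t)(i-t)}.$$ *)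

theory Defs
  imports Complex_Main "HOL-Library.Cardinality"
begin

definition grassmannian ::
  "('a::field \<Rightarrow> 'b::ab_group_add \<Rightarrow> 'b) \<Rightarrow> 'b set \<Rightarrow> nat \<Rightarrow> 'b set set" where
  "grassmannian scale X j =
     {V. module.subspace scale V \<and> V \<subseteq> X \<and> vector_space.dim scale V = j}"

definition point_set ::
  "('a::field \<Rightarrow> 'b::ab_group_add \<Rightarrow> 'b) \<Rightarrow> 'b set \<Rightarrow> 'b set set \<Rightarrow> bool" where
  "point_set scale X P \<longleftrightarrow> P \<noteq> {} \<and> P \<subseteq> grassmannian scale X 1"

text \<open>The sum of the subspaces in \<open>P\<close>, as the span of their union.\<close>
definition point_span ::
  "('a::field \<Rightarrow> 'b::ab_group_add \<Rightarrow> 'b) \<Rightarrow> 'b set set \<Rightarrow> 'b set" where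
  "point_span scale P = module.span scale (\<Union>P)"

definition distinguishes :: "'b set \<Rightarrow> 'b set set \<Rightarrow> bool" where
  "distinguishes V P \<longleftrightarrow> (\<forall>L\<in>P. \<not> L \<subseteq> V)"

definition delta ::
  "('a::field \<Rightarrow> 'b::ab_group_add \<Rightarrow> 'b) \<Rightarrow> 'b set \<Rightarrow> nat \<Rightarrow> 'b set set \<Rightarrow> real" where
  "delta scale X k P =
     real (card {V \<in> grassmannian scale X k. distinguishes V P})
       / real (card (grassmannian scale X k))"

definition point_sets ::
  "('a::field \<Rightarrow> 'b::ab_group_add \<Rightarrow> 'b) \<Rightarrow> 'b set \<Rightarrow> nat \<Rightarrow> nat \<Rightarrow> 'b set set set" where
  "point_sets scale X l r =
     {P. point_set scale X P \<and> card P = l \<and> vector_space.dim scale (point_span scale P) = r}"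

definition delta_hat ::
  "('a::field \<Rightarrow> 'b::ab_group_add \<Rightarrow> 'b) \<Rightarrow> 'b set \<Rightarrow> nat \<Rightarrow> nat \<Rightarrow> nat \<Rightarrow> real" where
  "delta_hat scale X k l r =
     (\<Sum>P\<in>point_sets scale X l r. delta scale X k P) / real (card (point_sets scale X l r))"

definition gauss_binomial :: "nat \<Rightarrow> int \<Rightarrow> int \<Rightarrow> real" where
  "gauss_binomial q a b =
     (if b < 0 \<or> b > a then 0
      else \<Prod>j<nat b. (real q ^ nat a - real q ^ j) / (real q ^ nat b - real q ^ j))"

text \<open>The terms with \<open>i < t\<close>, where the upper entry of the binomial coefficient and the last
  exponent can be negative, vanish because of the last Gaussian coefficient.\<close>
definition lambda :: "nat \<Rightarrow> nat \<Rightarrow> nat \<Rightarrow> nat \<Rightarrow> nat \<Rightarrow> real" where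
  "lambda q N s l r =
     (\<Sum>i=0..r. (-1) ^ (r - i) * real q ^ ((r - i) choose 2)
        * gauss_binomial q (int N - int i) (int r - int i)
        * (\<Sum>t=0..s. (((real q ^ i - real q ^ t) / (real q - 1)) gchoose l)
             * gauss_binomial q (int s) (int t)
             * gauss_binomial q (int N - int s) (int i - int t)
             * real q powi ((int s - int t) * (int i - int t))))"

end

theory Submission
  imports Defs
begin

text \<open>
  For a subspace \<open>V\<close> of dimension \<open>s\<close>, the number of point sets \<open>P\<close> with \<open>|P| = l\<close> and
  \<open>dim \<langle>P\<rangle> = r\<close> that are distinguished by \<open>V\<close> is \<open>lambda q N s l r\<close>, whatever \<open>V\<close> is; the theorem
  follows by counting the pairs \<open>(P, V)\<close> in two ways, the case \<open>s = 0\<close> giving the number of all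
  \<open>P\<close>. For that count, let \<open>g i\<close> be the number of pairs \<open>(P, U)\<close> where \<open>dim U = i\<close> and \<open>P\<close>
  consists of \<open>l\<close> points of \<open>U\<close> outside \<open>V\<close>. Sorting by \<open>t = dim (U \<inter> V)\<close> gives the inner sum of
  \<open>lambda\<close>; sorting by \<open>d = dim \<langle>P\<rangle>\<close> expresses \<open>g i\<close> through Gaussian coefficients \<open>[N - d, i - d]\<close>,
  and the alternating outer sum of \<open>lambda\<close> is the inverse of this triangular transformation, so it
  retains exactly the \<open>P\<close> with \<open>d = r\<close>.
\<close>

subsection \<open>Gaussian binomial coefficients\<close>

text \<open>Real base and natural entries make the q-identities accessible to induction. For
  \<open>a < b\<close> the factor at \<open>j = a\<close> makes the product zero.\<close>

definition qbinomial :: "real \<Rightarrow> nat \<Rightarrow> nat \<Rightarrow> real" where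
  "qbinomial q a b = (\<Prod>j<b. (q ^ a - q ^ j) / (q ^ b - q ^ j))"

text \<open>The usual q-factorial multiplied by \<open>(q - 1) ^ n\<close>; in Gaussian coefficients
  these powers cancel.\<close>

definition qfactorial :: "real \<Rightarrow> nat \<Rightarrow> real" where
  "qfactorial q n = (\<Prod>j<n. q ^ Suc j - 1)"

lemma qfactorial_0 [simp]: "qfactorial q 0 = 1"
  by (simp add: qfactorial_def)

lemma qfactorial_Suc: "qfactorial q (Suc n) = qfactorial q n * (q ^ Suc n - 1)"
  by (simp add: qfactorial_def)

lemma qbinomial_0_right [simp]: "qbinomial q n 0 = 1"
  by (simp add: qbinomial_def)

lemma qbinomial_eq_0: "a < b \<Longrightarrow> qbinomial q a b = 0"
  unfolding qbinomial_def by (rule prod_zero) auto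

lemma gauss_binomial_of_nat:
  "gauss_binomial q (int a) (int b) = qbinomial (real q) a b"
  by (auto simp: gauss_binomial_def qbinomial_eq_0) (simp add: qbinomial_def)

text \<open>Translates the integer entries in \<open>lambda\<close>. The case split is essential:
  truncated subtraction would turn a negative lower entry into 0 and the coefficient into 1.\<close>

lemma gauss_binomial_diff:
  assumes "c \<le> a"
  shows "gauss_binomial q (int a - int c) (int b - int d)
    = (if b < d then 0 else qbinomial (real q) (a - c) (b - d))"
proof (cases "b < d")
  case True
  then show ?thesis by (simp add: gauss_binomial_def)
next
  case False
  then have "int a - int c = int (a - c)" "int b - int d = int (b - d)"
    using assms by auto
  then show ?thesis
    using False by (simp only: gauss_binomial_of_nat if_False)
qed

context
  fixes q :: real
  assumes q: "q > 1"
begin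

lemma qfactorial_pos: "qfactorial q n > 0"
  unfolding qfactorial_def using q by (intro prod_pos) (auto simp: one_less_power simp del: power_Suc)

lemma qfactorial_nonzero [simp]: "qfactorial q n \<noteq> 0"
  using qfactorial_pos[of n] by simp

text \<open>Split off the factor at \<open>j = 0\<close>; in every other factor a common
  \<open>q\<close> cancels.\<close>

lemma qbinomial_Suc_Suc:
  "qbinomial q (Suc n) (Suc m) = (q ^ Suc n - 1) / (q ^ Suc m - 1) * qbinomial q n m"
proof -
  have "(q ^ Suc n - q ^ Suc j) / (q ^ Suc m - q ^ Suc j) = (q ^ n - q ^ j) / (q ^ m - q ^ j)" for j
    using q by (simp flip: right_diff_distrib)
  then show ?thesis
    unfolding qbinomial_def prod.lessThan_Suc_shift by (simp del: power_Suc)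
qed

lemma qbinomial_qfactorial:
  "qbinomial q (m + n) m = qfactorial q (m + n) / (qfactorial q m * qfactorial q n)"
proof (induction m)
  case 0
  then show ?case by simp
next
  case (Suc m)
  then show ?case
    using qbinomial_Suc_Suc[of "m + n" m] by (simp add: qfactorial_Suc mult_ac)
qed

lemma qbinomial_pos: "b \<le> a \<Longrightarrow> qbinomial q a b > 0"
  using qbinomial_qfactorial[of b "a - b"] by (simp add: qfactorial_pos)

lemma qbinomial_self [simp]: "qbinomial q n n = 1"
  using qbinomial_qfactorial[of n 0] by simp

lemma qbinomial_symmetric: "qbinomial q (m + n) m = qbinomial q (m + n) n"
  using qbinomial_qfactorial[of m n] qbinomial_qfactorial[of n m] by (simp add: add.commute)

text \<open>In terms of \<open>qfactorial\<close>, both sides are the factorial of \<open>a\<close>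
  divided by those of \<open>m\<close>, \<open>n - m\<close> and \<open>a - n\<close>.\<close>

lemma qbinomial_trinomial:
  assumes "m \<le> n" "n \<le> a"
  shows "qbinomial q (a - m) (n - m) * qbinomial q a m = qbinomial q a n * qbinomial q n m"
proof -
  obtain u v where "n = m + u" "a = m + u + v"
    using assms by (metis le_Suc_ex)
  then show ?thesis
    using qbinomial_qfactorial[of u v] qbinomial_qfactorial[of m "u + v"]
      qbinomial_qfactorial[of "m + u" v] qbinomial_qfactorial[of m u]
    by (simp add: add.assoc)
qed

lemma qbinomial_Suc_right:
  assumes "m < n"
  shows "qbinomial q n (Suc m) = (q ^ (n - m) - 1) / (q ^ Suc m - 1) * qbinomial q n m"
proof -
  obtain u where n: "n = Suc (m + u)"
    using assms less_iff_Suc_add by auto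
  have "q ^ Suc u - 1 \<noteq> 0"
    using q one_less_power[of q "Suc u"] by simp
  then show ?thesis
    using qbinomial_qfactorial[of "Suc m" u] qbinomial_qfactorial[of m "Suc u"] n
    by (simp add: qfactorial_Suc mult_ac)
qed

text \<open>Of the two q-Pascal rules, this is the one whose weight \<open>q ^ Suc m\<close> equals
  the growth of \<open>q ^ (Suc m choose 2)\<close> when \<open>m\<close> increases by one, as the
  alternating sum requires.\<close>

lemma qbinomial_pascal:
  assumes "m \<le> n"
  shows "qbinomial q (Suc n) (Suc m) = qbinomial q n m + q ^ Suc m * qbinomial q n (Suc m)"
proof (cases "m = n")
  case True
  then show ?thesis by (simp add: qbinomial_eq_0)
next
  case False
  then have m: "m < n" using assms by simp
  have nz: "q ^ Suc m - 1 \<noteq> 0"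
    using q one_less_power[of q "Suc m"] by simp
  have pw: "q ^ Suc m * q ^ (n - m) = q ^ Suc n"
    using m by (simp flip: power_add power_Suc)
  have "(q ^ Suc n - 1) / (q ^ Suc m - 1) = 1 + q ^ Suc m * ((q ^ (n - m) - 1) / (q ^ Suc m - 1))"
    using nz pw by (simp add: field_simps del: power_Suc)
  then show ?thesis
    unfolding qbinomial_Suc_Suc qbinomial_Suc_right[OF m]
    by (metis (no_types, lifting) distrib_right mult.assoc mult_1)
qed

text \<open>Pascal's rule makes the alternating sum telescope.\<close>
lemma alternating_qbinomial_partial_sum:
  assumes "p \<le> Suc n"
  shows "(\<Sum>m\<le>p. (-1) ^ m * q ^ (m choose 2) * qbinomial q (Suc n) m)
    = (-1) ^ p * q ^ (Suc p choose 2) * qbinomial q n p"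
  using assms
proof (induction p)
  case 0
  then show ?case by (simp add: numeral_2_eq_2)
next
  case (Suc p)
  have e: "Suc (Suc p) choose 2 = (Suc p choose 2) + Suc p"
    by (simp add: numeral_2_eq_2)
  show ?case
    using Suc qbinomial_pascal[of p n] unfolding e power_add
    by (simp add: algebra_simps)
qed

lemma alternating_qbinomial_sum:
  "(\<Sum>m\<le>n. (-1) ^ (n - m) * q ^ ((n - m) choose 2) * qbinomial q n m) = (if n = 0 then 1 else 0)"
proof -
  have "(\<Sum>m\<le>n. (-1) ^ (n - m) * q ^ ((n - m) choose 2) * qbinomial q n m)
      = (\<Sum>m\<le>n. (-1) ^ m * q ^ (m choose 2) * qbinomial q n m)"
  \<comment> \<open>The symmetry of Gaussian coefficients permits reversing the order of
    summation.\<close>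
  proof (rule sum.reindex_bij_witness[where i = "\<lambda>m. n - m" and j = "\<lambda>m. n - m"])
    fix m assume "m \<in> {..n}"
    then show "(- 1) ^ (n - m) * q ^ (n - m choose 2) * qbinomial q n (n - m) =
       (- 1) ^ (n - m) * q ^ (n - m choose 2) * qbinomial q n m"
      using qbinomial_symmetric[of m "n - m"] by simp
  qed auto
  also have "\<dots> = (if n = 0 then 1 else 0)"
    \<comment> \<open>For \<open>n > 0\<close> the full sum is the partial sum up to
      \<open>n\<close> in row \<open>Suc (n - 1)\<close>; its value contains
      \<open>qbinomial q (n - 1) n\<close>, which is 0.\<close>
    using alternating_qbinomial_partial_sum[of n "n - 1"]
    by (cases n) (auto simp: qbinomial_eq_0 numeral_2_eq_2)
  finally show ?thesis .
qed

text \<open>With \<open>i = d + m\<close> and \<open>r = d + u\<close>, the trinomial identity turns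
  the product of the two coefficients into \<open>qbinomial q (n - d) u * qbinomial q u m\<close>.
  The first factor is constant, and the alternating sum over row \<open>u\<close> remains.\<close>

lemma qbinomial_inversion:
  assumes "r \<le> n"
  shows "(\<Sum>i=0..r. (-1) ^ (r - i) * q ^ ((r - i) choose 2) * qbinomial q (n - i) (r - i)
      * (if i < d then 0 else qbinomial q (n - d) (i - d))) = (if d = r then 1 else 0)"
    (is "?L = _")
proof (cases "d \<le> r")
  case False
  then show ?thesis by (auto intro: sum.neutral)
next
  case True
  then obtain u where u: "r = d + u"
    using le_Suc_ex by blast
  let ?f = "\<lambda>i. (-1) ^ (r - i) * q ^ ((r - i) choose 2) * qbinomial q (n - i) (r - i)
      * (if i < d then 0 else qbinomial q (n - d) (i - d))"
  have "?L = sum ?f {d..d + u}"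
    unfolding u by (rule sum.mono_neutral_right) auto
  also have "\<dots> = (\<Sum>m\<le>u. ?f (d + m))"
    by (rule sum.reindex_bij_witness[where i = "\<lambda>m. d + m" and j = "\<lambda>i. i - d"]) auto
  also have "\<dots> = (\<Sum>m\<le>u. qbinomial q (n - d) u *
      ((-1) ^ (u - m) * q ^ ((u - m) choose 2) * qbinomial q u m))"
  proof (rule sum.cong[OF refl])
    fix m assume "m \<in> {..u}"
    then show "?f (d + m) = qbinomial q (n - d) u *
      ((-1) ^ (u - m) * q ^ ((u - m) choose 2) * qbinomial q u m)"
      using qbinomial_trinomial[of m u "n - d"] assms u by simp
  qed
  also have "\<dots> = (if d = r then 1 else 0)"
    using u by (auto simp: sum_distrib_left[symmetric] alternating_qbinomial_sum)
  finally show ?thesis .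
qed

end

subsection \<open>Counting subspaces over a finite field\<close>

locale finite_field_space = vector_space scale
  for scale :: "'f::{field,finite} \<Rightarrow> 'v::ab_group_add \<Rightarrow> 'v"
begin

lemma one_less_card_field: "1 < CARD('f)"
proof -
  have "card {0, 1 :: 'f} \<le> CARD('f)"
    by (intro card_mono) auto
  then show ?thesis by simp
qed

lemma span_of_subspace: "subspace S \<Longrightarrow> span S = S"
  by simp

text \<open>Each element of the larger span is \<open>x + scale c w\<close> for exactly one
  \<open>x\<close> in the smaller span and one scalar \<open>c\<close>.\<close>

lemma card_span_insert:
  assumes fin: "finite (span S)" and w: "w \<notin> span S"
  shows "finite (span (insert w S))" and "card (span (insert w S)) = CARD('f) * card (span S)"
proof -
  let ?f = "\<lambda>(c, x). x + scale c w"
  have "x \<in> ?f ` (UNIV \<times> span S)" if x: "x - scale c w \<in> span S" for x c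
    using that by (intro image_eqI[of _ _ "(c, x - scale c w)"]) auto
  moreover have "\<exists>k. y + scale c w - scale k w \<in> span S" if "y \<in> span S" for y c
    using that by (intro exI[of _ c]) simp
  ultimately have img: "span (insert w S) = ?f ` (UNIV \<times> span S)"
    unfolding span_insert by auto
  have "inj_on ?f (UNIV \<times> span S)"
  proof (rule inj_onI, clarify)
    fix c d x y assume *: "x \<in> span S" "y \<in> span S" "x + scale c w = y + scale d w"
    then have e: "x - y = scale (d - c) w"
      by (simp add: scale_left_diff_distrib algebra_simps)
    have "c = d"
    proof (rule ccontr)
      assume "c \<noteq> d"
      then have "w = scale (inverse (d - c)) (x - y)"
        unfolding e by simp
      then show False
        using w * by (metis span_diff span_scale)
    qed
    then show "c = d \<and> x = y" using * by simp
  qed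
  then show "card (span (insert w S)) = CARD('f) * card (span S)"
    by (simp add: img card_image card_cartesian_product)
  show "finite (span (insert w S))"
    using fin by (simp add: img)
qed

lemma card_span_independent:
  assumes "finite B" "independent B"
  shows "finite (span B) \<and> card (span B) = CARD('f) ^ card B"
  using assms
proof (induction rule: finite_induct)
  case (insert w B)
  then show ?case
    using card_span_insert[of B w] by (auto simp: independent_insert)
qed auto

text \<open>An infinite basis has \<open>card\<close> 0, so positive \<open>dim\<close> guarantees a
  finite basis, and over a finite field a finite span.\<close>

lemma finite_subspace:
  assumes "subspace S" "dim S > 0"
  shows "finite S"
proof -
  obtain B where B: "B \<subseteq> S" "independent B" "S \<subseteq> span B" "card B = dim S"
    using basis_exists by blast
  then have "finite B" using assms(2) card_gt_0_iff by metis
  then show ?thesis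
    using B card_span_independent finite_subset by blast
qed

lemma card_subspace:
  assumes "subspace S" "finite S"
  shows "card S = CARD('f) ^ dim S"
proof -
  obtain B where B: "B \<subseteq> S" "independent B" "S \<subseteq> span B" "card B = dim S"
    using basis_exists by blast
  then have "span B = S" "finite B"
    using assms span_subspace finite_subset by blast+
  then show ?thesis
    using B card_span_independent by metis
qed

lemma dim_eqI:
  assumes "subspace S" "finite S" "card S = CARD('f) ^ d"
  shows "dim S = d"
  using assms one_less_card_field by (simp add: card_subspace)

lemma dim_subspace_mono:
  assumes "subspace S" "subspace T" "S \<subseteq> T" "finite T"
  shows "dim S \<le> dim T"
proof -
  have "CARD('f) ^ dim S \<le> CARD('f) ^ dim T"
    using assms card_mono[of T S] by (simp add: card_subspace[symmetric] finite_subset)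
  then show ?thesis
    using one_less_card_field by simp
qed

lemma subspace_eqI:
  assumes "subspace S" "subspace T" "S \<subseteq> T" "finite T" "dim S = dim T"
  shows "S = T"
  using assms by (intro card_subset_eq) (auto simp: card_subspace finite_subset)

section \<open>Lists of vectors independent modulo a subspace\<close>

text \<open>For a subspace \<open>Z\<close>, this says that the list is linearly independent in the
  quotient by \<open>Z\<close>. Each entry is compared with its tail only, so lists can be counted
  one head at a time.\<close>

fun indep_over :: "'v set \<Rightarrow> 'v list \<Rightarrow> bool" where
  "indep_over Z [] \<longleftrightarrow> True"
| "indep_over Z (w # ws) \<longleftrightarrow> w \<notin> span (Z \<union> set ws) \<and> indep_over Z ws"

lemma indep_over_mono: "indep_over Z ws \<Longrightarrow> Y \<subseteq> Z \<Longrightarrow> indep_over Y ws"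
proof (induction ws)
  case (Cons w ws)
  then show ?case
    using span_mono[of "Y \<union> set ws" "Z \<union> set ws"] by auto
qed simp

text \<open>If \<open>w = v + x\<close> with \<open>v\<close> in \<open>V\<close> and
  \<open>x\<close> in the span of the tail, then \<open>v = w - x\<close> also lies in
  \<open>U\<close>. A dependence modulo \<open>V\<close> is thus already one modulo
  \<open>U \<inter> V\<close>.\<close>

lemma indep_over_Int:
  assumes "subspace U" "subspace V" "set ws \<subseteq> U" "indep_over (U \<inter> V) ws"
  shows "indep_over V ws"
  using assms(3,4)
proof (induction ws)
  case (Cons w ws)
  have "w \<notin> span (V \<union> set ws)"
  proof
    assume "w \<in> span (V \<union> set ws)"
    then obtain v x where w: "w = v + x" "v \<in> V" "x \<in> span (set ws)"
      using assms(2) by (auto simp: span_Un span_of_subspace)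
    have "x \<in> U"
      using w(3) Cons.prems(1) assms(1) span_minimal[of "set ws" U] by auto
    then have "v \<in> U"
      using w(1) Cons.prems(1) assms(1) subspace_diff[of U w x] by auto
    then have "w \<in> span ((U \<inter> V) \<union> set ws)"
      using w span_base[of v "U \<inter> V \<union> set ws"] span_mono[of "set ws" "U \<inter> V \<union> set ws"]
      by (auto intro: span_add)
    then show False using Cons.prems(2) by simp
  qed
  then show ?case using Cons by simp
qed simp

lemma card_span_indep_over:
  assumes "subspace Z" "finite Z" "indep_over Z ws"
  shows "finite (span (Z \<union> set ws)) \<and> card (span (Z \<union> set ws)) = CARD('f) ^ (dim Z + length ws)"
  using assms(3)
proof (induction ws)
  case Nil
  then show ?case using assms by (simp add: card_subspace span_of_subspace)
next
  case (Cons w ws)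
  then show ?case
    using card_span_insert[of "Z \<union> set ws" w] by auto
qed

text \<open>Adjoining vectors independent modulo \<open>V\<close> adds nothing inside
  \<open>V\<close>: an element of \<open>V\<close> with nonzero coefficient at \<open>w\<close>
  would put \<open>w\<close> into the span of \<open>V\<close> and the tail.\<close>

lemma span_indep_over_Int:
  assumes "subspace S" "S \<subseteq> V" "subspace V" "indep_over V ws"
  shows "span (S \<union> set ws) \<inter> V = S"
  using assms(4)
proof (induction ws)
  case Nil
  then show ?case using assms(1,2) by (auto simp: span_of_subspace)
next
  case (Cons w ws)
  have "y \<in> S" if y: "y \<in> span (insert w (S \<union> set ws))" "y \<in> V" for y
  proof -
    obtain c where c: "y - scale c w \<in> span (S \<union> set ws)"
      using y(1) by (auto simp: span_insert)
    have "c = 0"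
    proof (rule ccontr)
      assume "c \<noteq> 0"
      have "y - scale c w \<in> span (V \<union> set ws)"
        using c span_mono[of "S \<union> set ws" "V \<union> set ws"] assms(2) by auto
      moreover have "y \<in> span (V \<union> set ws)"
        using y(2) by (simp add: span_base)
      ultimately have "scale c w \<in> span (V \<union> set ws)"
        using span_diff[of y "V \<union> set ws" "y - scale c w"] by simp
      then have "w \<in> span (V \<union> set ws)"
        using \<open>c \<noteq> 0\<close> span_scale[of "scale c w" "V \<union> set ws" "inverse c"] by simp
      then show False using Cons.prems by simp
    qed
    then show "y \<in> S" using c y(2) Cons by auto
  qed
  moreover have "S \<subseteq> span (insert w (S \<union> set ws))"
    using span_superset[of "insert w (S \<union> set ws)"] by auto
  ultimately show ?case using assms(2) by auto
qed

definition indep_lists :: "'v set \<Rightarrow> 'v set \<Rightarrow> nat \<Rightarrow> 'v list set" where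
  "indep_lists Y Z m = {ws. set ws \<subseteq> Y \<and> length ws = m \<and> indep_over Z ws}"

lemma finite_indep_lists: "finite Y \<Longrightarrow> finite (indep_lists Y Z m)"
  by (rule finite_subset[OF _ finite_lists_length_eq[of Y m]]) (auto simp: indep_lists_def)

text \<open>A list of length \<open>b\<close> extends by any head outside a subspace of dimension
  \<open>dim Z + b\<close>. Once \<open>dim Z + b\<close> reaches \<open>dim Y\<close> a zero factor
  appears, so later negative factors do no harm.\<close>

lemma card_indep_lists:
  assumes Y: "subspace Y" "finite Y" and Z: "subspace Z" "Z \<subseteq> Y"
  shows "real (card (indep_lists Y Z m))
    = (\<Prod>b<m. real CARD('f) ^ dim Y - real CARD('f) ^ (dim Z + b))"
proof (induction m)
  case 0
  have "indep_lists Y Z 0 = {[]}" by (auto simp: indep_lists_def)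
  then show ?case by simp
next
  case (Suc m)
  let ?E = "\<lambda>ws. Y - span (Z \<union> set ws)"
  have "ws \<in> (\<lambda>(ws, w). w # ws) ` Sigma (indep_lists Y Z m) ?E"
    if "ws \<in> indep_lists Y Z (Suc m)" for ws
    using that by (cases ws) (auto simp: indep_lists_def image_iff)
  then have img: "indep_lists Y Z (Suc m) = (\<lambda>(ws, w). w # ws) ` Sigma (indep_lists Y Z m) ?E"
    by (auto simp: indep_lists_def)
  have "inj_on (\<lambda>(ws, w). w # ws) (Sigma (indep_lists Y Z m) ?E)"
    by (auto simp: inj_on_def)
  then have "card (indep_lists Y Z (Suc m)) = (\<Sum>ws\<in>indep_lists Y Z m. card (?E ws))"
    unfolding img using Y(2) by (subst card_image) (auto simp: finite_indep_lists)
  then have "real (card (indep_lists Y Z (Suc m))) = (\<Sum>ws\<in>indep_lists Y Z m. real (card (?E ws)))"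
    by simp
  also have "\<dots> = (\<Sum>ws\<in>indep_lists Y Z m. real CARD('f) ^ dim Y - real CARD('f) ^ (dim Z + m))"
  proof (rule sum.cong[OF refl])
    fix ws assume ws: "ws \<in> indep_lists Y Z m"
    have sub: "span (Z \<union> set ws) \<subseteq> Y"
      using ws Z(2) Y(1) by (intro span_minimal) (auto simp: indep_lists_def)
    have c: "card (span (Z \<union> set ws)) = CARD('f) ^ (dim Z + m)"
      using card_span_indep_over[of Z ws] Z Y(2) ws finite_subset by (auto simp: indep_lists_def)
    have "card (?E ws) = card Y - card (span (Z \<union> set ws))"
      using sub Y(2) by (intro card_Diff_subset) (auto intro: finite_subset)
    then have "real (card (?E ws)) = real (card Y) - real (card (span (Z \<union> set ws)))"
      using card_mono[OF Y(2) sub] by (simp add: of_nat_diff)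
    then show "real (card (?E ws)) = real CARD('f) ^ dim Y - real CARD('f) ^ (dim Z + m)"
      using c Y by (simp add: card_subspace)
  qed
  also have "\<dots> = (\<Prod>b<Suc m. real CARD('f) ^ dim Y - real CARD('f) ^ (dim Z + b))"
    by (simp add: Suc)
  finally show ?case .
qed

section \<open>Subspaces meeting a given subspace in a given dimension\<close>

lemma grassmannianD:
  assumes "U \<in> grassmannian scale X i"
  shows "subspace U" "U \<subseteq> X" "dim U = i"
  using assms by (auto simp: grassmannian_def)

lemma finite_grassmannian: "finite X \<Longrightarrow> finite (grassmannian scale X i)"
  by (rule finite_subset[of _ "Pow X"]) (auto simp: grassmannian_def)

lemma dim_zero_space [simp]: "dim {0} = 0"
  using dim_eqI[of "{0}" 0] by simp

lemma card_grassmannian_Int_mult: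
  assumes X: "subspace X" "finite X" and V: "subspace V" "V \<subseteq> X"
  shows "real (card {U \<in> grassmannian scale X (t + m). dim (U \<inter> V) = t})
      * ((\<Prod>a<t. real CARD('f) ^ t - real CARD('f) ^ a)
        * (\<Prod>b<m. real CARD('f) ^ (t + m) - real CARD('f) ^ (t + b)))
    = (\<Prod>a<t. real CARD('f) ^ dim V - real CARD('f) ^ a)
      * (\<Prod>b<m. real CARD('f) ^ dim X - real CARD('f) ^ (dim V + b))"
proof -
  \<comment> \<open>Each such \<open>U\<close> has the same number of bases consisting of a basis of \<open>U \<inter> V\<close> followed by
    vectors independent modulo \<open>V\<close>, so the pairs of lists in \<open>?A \<times> ?B\<close> are counted through their span.\<close>
  let ?A = "indep_lists V {0} t" and ?B = "indep_lists X V m"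
  let ?T = "{U \<in> grassmannian scale X (t + m). dim (U \<inter> V) = t}"
  let ?f = "\<lambda>(us, ws). span (set us \<union> set ws)"
  have finV: "finite V" using X V finite_subset by blast
  have finA: "finite ?A" "finite ?B"
    using X V finV by (auto intro: finite_indep_lists)
  have base: "subspace (span (set us))" "finite (span (set us))" "dim (span (set us)) = length us"
    if "indep_over {0} us" for us
    using card_span_indep_over[of "{0}" us] that dim_eqI[of "span (set us)" "length us"] by auto
  have span_Un_span: "span (span A \<union> B) = span (A \<union> B)" for A B
    by (simp add: span_Un span_span)
  have into: "?f ` (?A \<times> ?B) \<subseteq> ?T"
  proof clarsimp
    fix us ws assume us: "us \<in> ?A" and ws: "ws \<in> ?B"
    let ?S = "span (set us)"
    have SV: "?S \<subseteq> V"
      using us V by (intro span_minimal) (auto simp: indep_lists_def)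
    have b: "subspace ?S" "finite ?S" "dim ?S = t"
      using us base[of us] by (auto simp: indep_lists_def)
    have ind: "indep_over V ws" "length ws = m" "set ws \<subseteq> X"
      using ws by (auto simp: indep_lists_def)
    have "finite (span (?S \<union> set ws)) \<and> card (span (?S \<union> set ws)) = CARD('f) ^ (t + m)"
      using card_span_indep_over[of ?S ws] b ind indep_over_mono[of V ws ?S] SV by auto
    then have "dim (span (set us \<union> set ws)) = t + m"
      unfolding span_Un_span using dim_eqI by blast
    moreover have "span (set us \<union> set ws) \<subseteq> X"
      using us ind(3) V X by (intro span_minimal) (auto simp: indep_lists_def)
    moreover have "span (set us \<union> set ws) \<inter> V = ?S"
      using span_indep_over_Int[of ?S V ws] b SV V ind span_Un_span by metis
    ultimately show "span (set us \<union> set ws) \<in> grassmannian scale X (t + m)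
        \<and> dim (span (set us \<union> set ws) \<inter> V) = t"
      using b by (simp add: grassmannian_def)
  qed
  \<comment> \<open>The lists spanning \<open>U\<close> form a product of two sets of lists inside
    \<open>U\<close>, whose sizes depend only on \<open>t\<close> and \<open>m\<close>.\<close>
  have fibre: "{p. p \<in> ?A \<times> ?B \<and> ?f p = U} = indep_lists (U \<inter> V) {0} t \<times> indep_lists U (U \<inter> V) m"
    if U: "U \<in> ?T" for U
  proof -
    have sU: "subspace U" "U \<subseteq> X" "dim U = t + m" "dim (U \<inter> V) = t"
      using U by (auto simp: grassmannian_def)
    have sI: "subspace (U \<inter> V)" "finite (U \<inter> V)" "finite U"
      using sU V X finV finite_subset subspace_inter by auto
    have "us \<in> indep_lists (U \<inter> V) {0} t \<and> ws \<in> indep_lists U (U \<inter> V) m"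
      if "us \<in> ?A" "ws \<in> ?B" "span (set us \<union> set ws) = U" for us ws
      using that span_superset[of "set us \<union> set ws"] indep_over_mono[of V ws "U \<inter> V"]
      by (auto simp: indep_lists_def)
    moreover have "us \<in> ?A \<and> ws \<in> ?B \<and> span (set us \<union> set ws) = U"
      if us: "us \<in> indep_lists (U \<inter> V) {0} t" and ws: "ws \<in> indep_lists U (U \<inter> V) m" for us ws
    proof -
      have b: "subspace (span (set us))" "dim (span (set us)) = t"
        using us base[of us] by (auto simp: indep_lists_def)
      have "span (set us) \<subseteq> U \<inter> V"
        using us sI by (intro span_minimal) (auto simp: indep_lists_def)
      then have e: "span (set us) = U \<inter> V"
        using b sI sU by (intro subspace_eqI) auto
      have "finite (span (U \<inter> V \<union> set ws)) \<and> card (span (U \<inter> V \<union> set ws)) = CARD('f) ^ (t + m)"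
        using card_span_indep_over[of "U \<inter> V" ws] sI sU ws by (auto simp: indep_lists_def)
      then have d: "dim (span (U \<inter> V \<union> set ws)) = t + m"
        using dim_eqI by blast
      have "span (U \<inter> V \<union> set ws) \<subseteq> U"
        using ws sU by (intro span_minimal) (auto simp: indep_lists_def)
      then have "span (U \<inter> V \<union> set ws) = U"
        using d sU sI by (intro subspace_eqI) auto
      then have "span (set us \<union> set ws) = U"
        using e span_Un_span by metis
      moreover have "indep_over V ws"
        using ws sU V by (intro indep_over_Int[of U V]) (auto simp: indep_lists_def)
      ultimately show ?thesis
        using us ws sU by (auto simp: indep_lists_def)
    qed
    ultimately show ?thesis by auto
  qed
  \<comment> \<open>Sort the pairs by their span; all fibres have the same size.\<close>
  have "card (?A \<times> ?B) = (\<Sum>U\<in>?T. card {p. p \<in> ?A \<times> ?B \<and> ?f p = U})"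
    using sum.group[of "?A \<times> ?B" ?T ?f "\<lambda>_. 1::nat"] finA into X(2)
    by (simp add: finite_grassmannian)
  then have "real (card (?A \<times> ?B)) = (\<Sum>U\<in>?T. real (card {p. p \<in> ?A \<times> ?B \<and> ?f p = U}))"
    by simp
  also have "\<dots> = (\<Sum>U\<in>?T. (\<Prod>a<t. real CARD('f) ^ t - real CARD('f) ^ a)
        * (\<Prod>b<m. real CARD('f) ^ (t + m) - real CARD('f) ^ (t + b)))"
  proof (rule sum.cong[OF refl])
    fix U assume U: "U \<in> ?T"
    have sU: "subspace U" "U \<subseteq> X" "dim U = t + m" "dim (U \<inter> V) = t"
      using U by (auto simp: grassmannian_def)
    have sI: "subspace (U \<inter> V)" "finite (U \<inter> V)" "finite U" "{0} \<subseteq> U \<inter> V"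
      using sU V X finV finite_subset subspace_inter subspace_0 by auto
    show "real (card {p. p \<in> ?A \<times> ?B \<and> ?f p = U})
      = (\<Prod>a<t. real CARD('f) ^ t - real CARD('f) ^ a)
        * (\<Prod>b<m. real CARD('f) ^ (t + m) - real CARD('f) ^ (t + b))"
      unfolding fibre[OF U] card_cartesian_product
      using card_indep_lists[of "U \<inter> V" "{0}" t] card_indep_lists[of U "U \<inter> V" m] sU sI by simp
  qed
  finally show ?thesis
    using card_indep_lists[of V "{0}" t] card_indep_lists[of X V m] X V finV
    by (simp add: card_cartesian_product subspace_0)
qed

text \<open>Divide the preceding identity by its second factor. Extracting \<open>q ^ dim V\<close>
  above and \<open>q ^ t\<close> below from each of the \<open>m\<close> shifted factors leaves two
  Gaussian coefficients and the power of \<open>q\<close>.\<close>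

lemma card_grassmannian_Int:
  assumes X: "subspace X" "finite X" and V: "subspace V" "V \<subseteq> X" and t: "t \<le> dim V"
  shows "real (card {U \<in> grassmannian scale X (t + m). dim (U \<inter> V) = t})
    = qbinomial (real CARD('f)) (dim V) t * qbinomial (real CARD('f)) (dim X - dim V) m
      * real CARD('f) ^ ((dim V - t) * m)"
proof -
  let ?q = "real CARD('f)"
  have q: "?q > 1" using one_less_card_field by simp
  have shift: "(\<Prod>b<m. ?q ^ (c + d) - ?q ^ (c + b)) = ?q ^ (c * m) * (\<Prod>b<m. ?q ^ d - ?q ^ b)" for c d
  proof -
    have "(\<Prod>b<m. ?q ^ (c + d) - ?q ^ (c + b)) = (\<Prod>b<m. ?q ^ c * (?q ^ d - ?q ^ b))"
      by (simp add: power_add algebra_simps)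
    then show ?thesis by (simp add: prod.distrib power_mult)
  qed
  have nz: "(\<Prod>a<c. ?q ^ c - ?q ^ a) \<noteq> 0" for c
    using q by (auto simp: power_inject_exp)
  have dX: "dim X = dim V + (dim X - dim V)"
    using dim_subspace_mono[of V X] X V by simp
  have pw: "?q ^ (dim V * m) = ?q ^ (t * m) * ?q ^ ((dim V - t) * m)"
    using t by (simp flip: power_add add_mult_distrib)
  have "?q ^ (t * m) \<noteq> 0" by simp
  then show ?thesis
    using card_grassmannian_Int_mult[OF X V, of t m] nz[of t] nz[of m]
    unfolding qbinomial_def prod_dividef
    \<comment> \<open>Writing \<open>dim X\<close> as \<open>dim V\<close> plus the codimension
      gives the numerator the form expected by \<open>shift\<close>.\<close>
    apply (subst (asm) dX)
    unfolding shift pw by (simp add: field_simps)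
qed

subsection \<open>Counting distinguished point sets\<close>

lemma card_grassmannian:
  assumes "subspace X" "finite X"
  shows "real (card (grassmannian scale X m)) = qbinomial (real CARD('f)) (dim X) m"
proof -
  have "{U \<in> grassmannian scale X (0 + m). dim (U \<inter> {0}) = 0} = grassmannian scale X m"
  proof -
    have "U \<inter> {0} = {0}" if "U \<in> grassmannian scale X m" for U
      using grassmannianD[OF that] subspace_0 by auto
    then show ?thesis by auto
  qed
  then show ?thesis
    using card_grassmannian_Int[of X "{0}" 0 m] assms by (simp add: subspace_0)
qed

text \<open>The points of \<open>U\<close> inside \<open>V\<close> are the points of
  \<open>U \<inter> V\<close>, and a space of dimension \<open>d\<close> has
  \<open>(q ^ d - 1) / (q - 1)\<close> points.\<close>

lemma card_points_avoiding:
  assumes U: "subspace U" "finite U" and V: "subspace V"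
  shows "real (card {L \<in> grassmannian scale U 1. \<not> L \<subseteq> V})
    = (real CARD('f) ^ dim U - real CARD('f) ^ dim (U \<inter> V)) / (real CARD('f) - 1)"
proof -
  have pts: "real (card (grassmannian scale W 1)) = (real CARD('f) ^ dim W - 1) / (real CARD('f) - 1)"
    if "subspace W" "finite W" for W
    using card_grassmannian[OF that, of 1] by (simp add: qbinomial_def)
  have eq: "{L \<in> grassmannian scale U 1. \<not> L \<subseteq> V} = grassmannian scale U 1 - grassmannian scale (U \<inter> V) 1"
    by (auto simp: grassmannian_def)
  have sub: "grassmannian scale (U \<inter> V) 1 \<subseteq> grassmannian scale U 1"
    by (auto simp: grassmannian_def)
  have fin: "finite (grassmannian scale (U \<inter> V) 1)" "finite (grassmannian scale U 1)"
    using U by (auto intro: finite_grassmannian)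
  have "real (card {L \<in> grassmannian scale U 1. \<not> L \<subseteq> V})
      = real (card (grassmannian scale U 1)) - real (card (grassmannian scale (U \<inter> V) 1))"
    unfolding eq using card_Diff_subset[OF fin(1) sub] card_mono[OF fin(2) sub] by (simp add: of_nat_diff)
  then show ?thesis
    using pts[of U] pts[of "U \<inter> V"] U V subspace_inter by (simp add: diff_divide_distrib)
qed

text \<open>Containing \<open>W\<close> means meeting \<open>W\<close> in full dimension, so this is
  \<open>card_grassmannian_Int\<close> with \<open>t = dim W\<close>, where the first coefficient
  and the power of \<open>q\<close> are 1.\<close>

lemma card_superspaces:
  assumes X: "subspace X" "finite X" and W: "subspace W" "W \<subseteq> X"
  shows "real (card {U \<in> grassmannian scale X i. W \<subseteq> U})
    = (if i < dim W then 0 else qbinomial (real CARD('f)) (dim X - dim W) (i - dim W))"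
proof (cases "i < dim W")
  case True
  have "{U \<in> grassmannian scale X i. W \<subseteq> U} = {}"
    using True dim_subspace_mono[OF W(1)] X(2) by (auto simp: grassmannian_def) (meson finite_subset leD)
  then show ?thesis using True by (simp only: card.empty) simp
next
  case False
  have finW: "finite W" using X W finite_subset by blast
  have "dim (U \<inter> W) = dim W \<longleftrightarrow> W \<subseteq> U" if "U \<in> grassmannian scale X i" for U
    using subspace_eqI[of "U \<inter> W" W] grassmannianD(1)[OF that] W finW
    by (auto simp: subspace_inter Int_absorb1)
  then have "{U \<in> grassmannian scale X i. W \<subseteq> U} = {U \<in> grassmannian scale X i. dim (U \<inter> W) = dim W}"
    by auto
  then show ?thesis
    using card_grassmannian_Int[OF X W order_refl, of "i - dim W"] False one_less_card_field by simp
qed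

lemma point_span_subset_iff:
  "subspace U \<Longrightarrow> point_span scale P \<subseteq> U \<longleftrightarrow> (\<forall>L\<in>P. L \<subseteq> U)"
  unfolding point_span_def using span_minimal[of "\<Union>P" U] span_superset[of "\<Union>P"] by auto

lemma sum_choose_avoiding_points:
  assumes X: "subspace X" "finite X" and V: "subspace V" "V \<subseteq> X"
  shows "(\<Sum>U\<in>grassmannian scale X i. real (card {L \<in> grassmannian scale U 1. \<not> L \<subseteq> V} choose l))
    = (\<Sum>t=0..dim V. (((real CARD('f) ^ i - real CARD('f) ^ t) / (real CARD('f) - 1)) gchoose l)
             * gauss_binomial CARD('f) (int (dim V)) (int t)
             * gauss_binomial CARD('f) (int (dim X) - int (dim V)) (int i - int t)
             * real CARD('f) powi ((int (dim V) - int t) * (int i - int t)))"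
proof -
  let ?q = "real CARD('f)" and ?G = "grassmannian scale X i"
  let ?h = "\<lambda>t. ((?q ^ i - ?q ^ t) / (?q - 1)) gchoose l"
  have finV: "finite V" using X V finite_subset by blast
  have VX: "dim V \<le> dim X" using dim_subspace_mono X V by blast
  have le: "dim (U \<inter> V) \<le> dim V" "dim (U \<inter> V) \<le> i" if "U \<in> ?G" for U
    using grassmannianD[OF that] V X finV
    by (auto intro!: dim_subspace_mono subspace_inter intro: finite_subset)
  have "(\<Sum>U\<in>?G. real (card {L \<in> grassmannian scale U 1. \<not> L \<subseteq> V} choose l))
      = (\<Sum>U\<in>?G. ?h (dim (U \<inter> V)))"
  proof (rule sum.cong[OF refl])
    fix U assume "U \<in> ?G"
    then have U: "subspace U" "finite U" "dim U = i"
      using X(2) by (auto simp: grassmannian_def intro: finite_subset)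
    show "real (card {L \<in> grassmannian scale U 1. \<not> L \<subseteq> V} choose l) = ?h (dim (U \<inter> V))"
      unfolding binomial_gbinomial using card_points_avoiding[OF U(1,2) V(1)] U(3) by simp
  qed
  also have "\<dots> = (\<Sum>t=0..dim V. \<Sum>U | U \<in> ?G \<and> dim (U \<inter> V) = t. ?h (dim (U \<inter> V)))"
    using le X by (intro sum.group[symmetric]) (auto simp: finite_grassmannian)
  also have "\<dots> = (\<Sum>t=0..dim V. ?h t * real (card {U \<in> ?G. dim (U \<inter> V) = t}))"
    by (intro sum.cong[OF refl]) (simp add: mult.commute)
  also have "\<dots> = (\<Sum>t=0..dim V. ?h t * gauss_binomial CARD('f) (int (dim V)) (int t)
             * gauss_binomial CARD('f) (int (dim X) - int (dim V)) (int i - int t)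
             * ?q powi ((int (dim V) - int t) * (int i - int t)))"
  proof (rule sum.cong[OF refl])
    fix t assume t: "t \<in> {0..dim V}"
    have "real (card {U \<in> ?G. dim (U \<inter> V) = t}) = gauss_binomial CARD('f) (int (dim V)) (int t)
             * gauss_binomial CARD('f) (int (dim X) - int (dim V)) (int i - int t)
             * ?q powi ((int (dim V) - int t) * (int i - int t))"
    \<comment> \<open>For \<open>i < t\<close> no such \<open>U\<close> exists and the last Gaussian
      coefficient is 0; otherwise the integer exponent is a natural number.\<close>
    proof (cases "i < t")
      case True
      then have "{U \<in> ?G. dim (U \<inter> V) = t} = {}"
        using le by fastforce
      then show ?thesis
        using True by (simp only: gauss_binomial_diff[OF VX] card.empty) simp
    next
      case False
      have "(int (dim V) - int t) * (int i - int t) = int ((dim V - t) * (i - t))"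
        using False t by (simp add: of_nat_diff)
      then show ?thesis
        using card_grassmannian_Int[OF X V, of t "i - t"] False t
        by (simp only: gauss_binomial_diff[OF VX] gauss_binomial_of_nat power_int_of_nat) simp
    qed
    then show "?h t * real (card {U \<in> ?G. dim (U \<inter> V) = t})
        = ?h t * gauss_binomial CARD('f) (int (dim V)) (int t)
             * gauss_binomial CARD('f) (int (dim X) - int (dim V)) (int i - int t)
             * ?q powi ((int (dim V) - int t) * (int i - int t))"
      by (simp only: mult.assoc)
  qed
  finally show ?thesis .
qed

lemma card_distinguished_point_sets:
  assumes X: "subspace X" "finite X" and V: "subspace V" "V \<subseteq> X" and l: "0 < l" and r: "r \<le> dim X"
  shows "real (card {P \<in> point_sets scale X l r. distinguishes V P})
    = lambda CARD('f) (dim X) (dim V) l r"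
proof -
  let ?q = "real CARD('f)"
  \<comment> \<open>The dimension of the span is left free here; the inversion selects it
    later.\<close>
  let ?PS = "{P. P \<subseteq> grassmannian scale X 1 \<and> card P = l \<and> distinguishes V P}"
  let ?d = "\<lambda>P. dim (point_span scale P)"
  let ?n = "\<lambda>i P. if i < ?d P then 0 else qbinomial ?q (dim X - ?d P) (i - ?d P)"
  let ?c = "\<lambda>i. (-1) ^ (r - i) * ?q ^ ((r - i) choose 2) * qbinomial ?q (dim X - i) (r - i)"
  have q: "1 < ?q" using one_less_card_field by simp
  have finPS: "finite ?PS"
    by (rule finite_subset[of _ "Pow (grassmannian scale X 1)"]) (auto simp: finite_grassmannian X)
  have sp: "subspace (point_span scale P)" "point_span scale P \<subseteq> X" if "P \<in> ?PS" for P
    using that X by (auto simp: point_span_subset_iff grassmannian_def) (auto simp: point_span_def)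
  \<comment> \<open>Count pairs of \<open>P\<close> and an \<open>i\<close>-dimensional
    \<open>U\<close> containing its span, first by \<open>P\<close>, then by
    \<open>U\<close>.\<close>
  have g: "(\<Sum>P\<in>?PS. ?n i P)
      = (\<Sum>U\<in>grassmannian scale X i. real (card {L \<in> grassmannian scale U 1. \<not> L \<subseteq> V} choose l))" for i
  proof -
    let ?G = "grassmannian scale X i"
    have "(\<Sum>P\<in>?PS. ?n i P) = (\<Sum>P\<in>?PS. real (card {U \<in> ?G. point_span scale P \<subseteq> U}))"
      using sp card_superspaces[OF X] by (intro sum.cong) auto
    also have "\<dots> = (\<Sum>P\<in>?PS. \<Sum>U | U \<in> ?G \<and> point_span scale P \<subseteq> U. 1)"
      by simp
    also have "\<dots> = (\<Sum>U\<in>?G. \<Sum>P | P \<in> ?PS \<and> point_span scale P \<subseteq> U. 1)"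
      using finPS X by (intro sum.swap_restrict) (auto simp: finite_grassmannian)
    also have "\<dots> = (\<Sum>U\<in>?G. real (card {P. P \<in> ?PS \<and> point_span scale P \<subseteq> U}))"
      by simp
    also have "\<dots> = (\<Sum>U\<in>?G. real (card {L \<in> grassmannian scale U 1. \<not> L \<subseteq> V} choose l))"
    proof (rule sum.cong[OF refl])
      fix U assume "U \<in> ?G"
      then have U: "subspace U" "U \<subseteq> X" "finite U"
        using X(2) by (auto simp: grassmannian_def intro: finite_subset)
      \<comment> \<open>Once \<open>U\<close> is fixed, such a \<open>P\<close> is any choice of
        \<open>l\<close> points of \<open>U\<close> outside \<open>V\<close>.\<close>
      have "{P. P \<in> ?PS \<and> point_span scale P \<subseteq> U}
          = {P. P \<subseteq> {L \<in> grassmannian scale U 1. \<not> L \<subseteq> V} \<and> card P = l}"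
        using U(2) by (auto simp: point_span_subset_iff[OF U(1)] grassmannian_def distinguishes_def)
      then show "real (card {P. P \<in> ?PS \<and> point_span scale P \<subseteq> U})
          = real (card {L \<in> grassmannian scale U 1. \<not> L \<subseteq> V} choose l)"
        using U(3) by (simp add: n_subsets finite_grassmannian)
    qed
    finally show ?thesis .
  qed
  have "lambda CARD('f) (dim X) (dim V) l r = (\<Sum>i=0..r. ?c i * (\<Sum>P\<in>?PS. ?n i P))"
    unfolding lambda_def sum_choose_avoiding_points[OF X V, symmetric] g
    using r by (intro sum.cong[OF refl]) (simp add: gauss_binomial_diff)
  also have "\<dots> = (\<Sum>P\<in>?PS. \<Sum>i=0..r. ?c i * ?n i P)"
    unfolding sum_distrib_left by (rule sum.swap)
  also have "\<dots> = (\<Sum>P\<in>?PS. if ?d P = r then 1 else 0)"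
    using qbinomial_inversion[OF q r] by (intro sum.cong[OF refl])
  also have "\<dots> = real (card {P \<in> ?PS. ?d P = r})"
    using finPS by (simp add: sum.If_cases Int_def)
  \<comment> \<open>\<open>0 < l\<close> supplies the nonemptiness demanded by
    \<open>point_set\<close>.\<close>
  also have "{P \<in> ?PS. ?d P = r} = {P \<in> point_sets scale X l r. distinguishes V P}"
    using l by (auto simp: point_sets_def point_set_def)
  finally show ?thesis by simp
qed

lemma delta_hat_eq_lambda_quotient:
  assumes X: "subspace X" "finite X" and "0 < l" "r \<le> dim X" "k \<le> dim X"
  shows "delta_hat scale X k l r
    = lambda CARD('f) (dim X) k l r / lambda CARD('f) (dim X) 0 l r"
proof -
  let ?PS = "point_sets scale X l r" and ?G = "grassmannian scale X k"
  have finPS: "finite ?PS"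
    by (rule finite_subset[of _ "Pow (grassmannian scale X 1)"])
      (auto simp: finite_grassmannian X point_sets_def point_set_def)
  have finG: "finite ?G" using X by (simp add: finite_grassmannian)
  have G: "real (card ?G) \<noteq> 0"
    using card_grassmannian[OF X, of k] qbinomial_pos[of "real CARD('f)" k "dim X"]
      one_less_card_field assms(5) by simp
  \<comment> \<open>The zero space contains no point, so the count for \<open>V = {0}\<close> is the
    number of all point sets.\<close>
  have "distinguishes {0} P" if "P \<in> ?PS" for P
    unfolding distinguishes_def
  proof (intro ballI notI)
    fix L assume "L \<in> P" "L \<subseteq> {0}"
    then have "subspace L" "dim L = 1"
      using that by (auto simp: point_sets_def point_set_def grassmannian_def)
    then show False
      using \<open>L \<subseteq> {0}\<close> dim_subspace_mono[of L "{0}"] by simp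
  qed
  then have "{P \<in> ?PS. distinguishes {0} P} = ?PS" by auto
  then have card_PS: "real (card ?PS) = lambda CARD('f) (dim X) 0 l r"
    using card_distinguished_point_sets[OF X, of "{0}" l r] X assms by (simp add: subspace_0)
  have "(\<Sum>P\<in>?PS. delta scale X k P)
      = (\<Sum>P\<in>?PS. \<Sum>V | V \<in> ?G \<and> distinguishes V P. 1) / real (card ?G)"
    by (simp add: delta_def sum_divide_distrib)
  also have "(\<Sum>P\<in>?PS. \<Sum>V | V \<in> ?G \<and> distinguishes V P. 1 :: real)
      = (\<Sum>V\<in>?G. \<Sum>P | P \<in> ?PS \<and> distinguishes V P. 1)"
    using finPS finG by (rule sum.swap_restrict)
  \<comment> \<open>The inner count is the same for every \<open>V\<close>, so the number of
    subspaces cancels against the denominator of \<open>delta\<close>.\<close>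
  also have "\<dots> = (\<Sum>V\<in>?G. lambda CARD('f) (dim X) k l r)"
  proof (rule sum.cong[OF refl])
    fix V assume "V \<in> ?G"
    note V = grassmannianD[OF this]
    show "(\<Sum>P | P \<in> ?PS \<and> distinguishes V P. 1) = lambda CARD('f) (dim X) k l r"
      using card_distinguished_point_sets[OF X V(1,2) assms(3,4)] V(3) by simp
  qed
  finally show ?thesis
    using G card_PS by (simp add: delta_hat_def)
qed

end

theorem theorem5p5:
  fixes scale :: "'f::{field,finite} \<Rightarrow> 'v::ab_group_add \<Rightarrow> 'v"
    and X :: "'v set" and q N k l r :: nat
  assumes "vector_space scale"
    and "module.subspace scale X"
    and "vector_space.dim scale X = N"
    and "q = CARD('f)"
    and "N \<ge> 3"
    and "1 \<le> k" and "k \<le> N - 1"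
    and "2 \<le> r" and "r \<le> N"
    and "r \<le> l" and "real l \<le> (real q ^ r - 1) / (real q - 1)"
  shows "delta_hat scale X k l r = lambda q N k l r / lambda q N 0 l r"
proof -
  interpret finite_field_space scale
    using assms(1) by (simp add: finite_field_space_def)
  \<comment> \<open>Finiteness comes from \<open>dim X = N\<close> being positive.\<close>
  have "finite X"
    using finite_subspace assms by simp
  then show ?thesis
    using delta_hat_eq_lambda_quotient[of X l r k] assms by simp
qed

end
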